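(* For all integers $n\ge 0$, $$F_{n+1}^2=S_n+\sum_{k=2}^nF^2_{k-1}S_{n-k},$$ where $S_n$ is the number of ways to tile an $n$-board using half-squares and $(\frac12,\frac12)$-fences such that no free bifences occur.
   Context: The Fibonacci numbers are $F_0=0$, $F_1=1$, $F_n=F_{n-1}+F_{n-2}$ for $n\ge2$. Empty sums are $0$. An $n$-board is a $1\times n$ array of $n$ unit square cells in a row (horizontal extent $[0,n]$). A half-square is a tile of width $\frac12$ and height $1$, covering a horizontal interval $[x,x+\frac12]$. A $(\frac12,\frac12)$-fence is a single tile composed of two pieces (posts), each of width $\frac12$ and height $1$, separated by a gap of width $\frac12$; it covers $[x,x+\frac12]\cup[x+1,x+\frac32]$ for some $x$. Tiles are not rotated. Tiles need not be aligned with the cell boundaries, and the gap of a fence must be covered by other tiles. A tiling covers the board exactly, with no overlaps (of interiors), no uncovered region and nothing protruding from the board. There is exactly one (empty) tiling of the $0$-board. A metatile is a minimal (nonempty) arrangement of tiles that exactly covers an integral number of adjacent cells; every tiling of a board is uniquely a concatenation of metatiles. A bifence is a pair of interlocking fences, i.e. fences starting at $x$ and $x+\frac12$, together covering exactly $[x,x+2]$. A bifence in a tiling is free if it is not part of a larger metatile (i.e. it is by itself one of the metatiles of the tiling). The numbers $S_n$ satisfy $S_0=S_1=1$ and $S_n=2S_{n-1}+S_{n-2}$ for $n\ge2$. *)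

theory Defs
  imports "HOL-Analysis.Analysis" "HOL-Number_Theory.Fib"
begin

text \<open>
  All tiles and boards have height 1 and tiles are not rotated, so only horizontal extents are
  recorded. The argument of a tile is the real position of its left edge; in particular nothing
  forces tiles to be aligned with cells or half-cells.
\<close>

datatype tile = HalfSquare real | Fence real

fun region :: "tile \<Rightarrow> real set" where
  "region (HalfSquare x) = {x..x + 1/2}"
| "region (Fence x) = {x..x + 1/2} \<union> {x + 1..x + 3/2}"

definition cells :: "nat \<Rightarrow> nat \<Rightarrow> real set" where
  "cells a b = (\<Union>i\<in>{a..<b}. {real i..real i + 1})"

text \<open>
  For \<open>n > 0\<close> the board is the interval from \<open>0\<close> to \<open>n\<close>. As a union of \<open>n\<close> cells
  the 0-board is empty (not a single point), so that the empty arrangement tiles it.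
\<close>

definition board :: "nat \<Rightarrow> real set" where
  "board n = cells 0 n"

definition exactly_covers :: "tile set \<Rightarrow> real set \<Rightarrow> bool" where
  "exactly_covers T A \<longleftrightarrow>
     pairwise (\<lambda>s t. interior (region s) \<inter> interior (region t) = {}) T \<and>
     (\<Union>t\<in>T. region t) = A"

definition tiling :: "nat \<Rightarrow> tile set \<Rightarrow> bool" where
  "tiling n T \<longleftrightarrow> exactly_covers T (board n)"

definition covers_cells :: "tile set \<Rightarrow> bool" where
  "covers_cells M \<longleftrightarrow> (\<exists>a b. exactly_covers M (cells a b))"

definition metatile :: "tile set \<Rightarrow> bool" where
  "metatile M \<longleftrightarrow> M \<noteq> {} \<and> covers_cells M \<and> (\<forall>N. N \<subset> M \<and> N \<noteq> {} \<longrightarrow> \<not> covers_cells N)"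

definition bifence :: "real \<Rightarrow> tile set" where
  "bifence x = {Fence x, Fence (x + 1/2)}"

text \<open>
  The metatiles into which a tiling \<open>T\<close> decomposes are exactly the subsets of \<open>T\<close> that are
  metatiles: the gap of a fence is narrower than a cell, so no tile of \<open>T\<close> reaches across a block of
  whole cells that is exactly covered by other tiles.
\<close>

definition free_bifence_in :: "tile set \<Rightarrow> real \<Rightarrow> bool" where
  "free_bifence_in T x \<longleftrightarrow> bifence x \<subseteq> T \<and> metatile (bifence x)"

definition S :: "nat \<Rightarrow> nat" where
  "S n = card {T. tiling n T \<and> \<not> (\<exists>x. free_bifence_in T x)}"

end

theory Submission
  imports Defs
begin

text \<open>
  In a tiling the posts of the tiles are exactly the \<open>2 * n\<close> half-cells. A fence joins a
  half-cell to the one a unit further on, so the tiling splits into two independent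
  square-and-domino tilings of \<open>n\<close> cells, one by the left and one by the right halves of the
  cells; this gives \<open>F\<^sub>n\<^sub>+\<^sub>1\<^sup>2\<close> tilings. A free bifence is a domino that occurs at the same place
  in both. Splitting the pairs of domino tilings at their last common domino yields the
  identity.
\<close>

section \<open>Square-and-domino tilings and Fibonacci numbers\<close>

text \<open>A square-and-domino tiling of \<open>n\<close> cells is encoded by the left cells of its dominoes.\<close>

definition domino_sets :: "nat \<Rightarrow> nat set set" where
  "domino_sets n = {D. \<forall>i\<in>D. Suc i < n \<and> Suc i \<notin> D}"

lemma domino_sets_subset: "D \<in> domino_sets n \<Longrightarrow> D \<subseteq> {..<n}"
  by (auto simp: domino_sets_def)

lemma finite_domino_sets: "finite (domino_sets n)"
  by (rule finite_subset[of _ "Pow {..<n}"]) (auto dest: domino_sets_subset)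

text \<open>The last cell is either a square, which leaves \<open>Suc n\<close> cells, or the right
  end of a domino at \<open>n\<close>, which leaves \<open>n\<close> cells.\<close>

lemma domino_sets_Suc_Suc:
  "domino_sets (Suc (Suc n)) = domino_sets (Suc n) \<union> insert n ` domino_sets n"
proof (intro equalityI subsetI)
  fix D assume D: "D \<in> domino_sets (Suc (Suc n))"
  show "D \<in> domino_sets (Suc n) \<union> insert n ` domino_sets n"
  proof (cases "n \<in> D")
    case True
    then have "D - {n} \<in> domino_sets n"
      using D by (fastforce simp: domino_sets_def less_Suc_eq)
    moreover have "D = insert n (D - {n})" using True by blast
    ultimately show ?thesis by blast
  next
    case False
    then show ?thesis using D by (fastforce simp: domino_sets_def less_Suc_eq)
  qed
qed (auto simp: domino_sets_def)

lemma card_domino_sets: "card (domino_sets n) = fib (n + 1)"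
proof (induction n rule: fib.induct)
  case 1
  have "domino_sets 0 = {{}}" by (auto simp: domino_sets_def)
  then show ?case by simp
next
  case 2
  have "domino_sets (Suc 0) = {{}}" by (auto simp: domino_sets_def)
  then show ?case by simp
next
  case (3 n)
  have "inj_on (insert n) (domino_sets n)"
    by (rule inj_onI) (metis domino_sets_subset insert_ident lessThan_iff less_irrefl subsetD)
  moreover have "domino_sets (Suc n) \<inter> insert n ` domino_sets n = {}"
    by (auto simp: domino_sets_def)
  ultimately show ?case
    using 3 by (simp add: domino_sets_Suc_Suc card_Un_disjoint finite_domino_sets card_image)
qed

section \<open>Splitting pairs at their last common domino\<close>

text \<open>\<open>L\<close> describes the \<open>m\<close> cells left of the domino at
  \<open>m\<close>. \<open>R\<close> describes the cells from \<open>m + 2\<close> on, renumbered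
  from 0.\<close>

definition domino_join :: "nat \<Rightarrow> nat set \<Rightarrow> nat set \<Rightarrow> nat set" where
  "domino_join m L R = insert m (L \<union> (\<lambda>i. i + m + 2) ` R)"

lemma domino_join_left:
  "L \<in> domino_sets m \<Longrightarrow> domino_join m L R \<inter> {..<m} = L"
  using domino_sets_subset by (fastforce simp: domino_join_def)

lemma domino_join_right:
  "L \<in> domino_sets m \<Longrightarrow> {i. i + m + 2 \<in> domino_join m L R} = R"
  using domino_sets_subset by (fastforce simp: domino_join_def)

lemma domino_join_in:
  assumes "L \<in> domino_sets m" "R \<in> domino_sets r"
  shows "domino_join m L R \<in> domino_sets (m + 2 + r)"
  using assms by (fastforce simp: domino_sets_def domino_join_def)

text \<open>Dominoes do not overlap, so \<open>m\<close> in \<open>D\<close> keeps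
  \<open>m - 1\<close> and \<open>m + 1\<close> out of \<open>D\<close>. Hence no domino crosses
  either end of the one at \<open>m\<close>, and both sides can be cut off cleanly.\<close>

lemma domino_join_split:
  assumes "D \<in> domino_sets (m + 2 + r)" "m \<in> D"
  shows "D \<inter> {..<m} \<in> domino_sets m" "{i. i + m + 2 \<in> D} \<in> domino_sets r"
    "domino_join m (D \<inter> {..<m}) {i. i + m + 2 \<in> D} = D"
proof -
  show "D \<inter> {..<m} \<in> domino_sets m"
    using assms by (auto simp: domino_sets_def) (metis Suc_lessI)
  show "{i. i + m + 2 \<in> D} \<in> domino_sets r"
    using assms by (force simp: domino_sets_def)
  have "x \<in> (\<lambda>i. i + m + 2) ` {i. i + m + 2 \<in> D}" if "x \<in> D" "x \<noteq> m" "\<not> x < m" for x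
  proof -
    \<comment> \<open>This gives \<open>x \<ge> m + 2\<close>, so the truncated subtraction in the
      next step is exact.\<close>
    have "x \<noteq> Suc m" using assms that by (auto simp: domino_sets_def)
    then have "x = (x - m - 2) + m + 2" using that by simp
    then show ?thesis using that by (metis (mono_tags, lifting) image_eqI mem_Collect_eq)
  qed
  then show "domino_join m (D \<inter> {..<m}) {i. i + m + 2 \<in> D} = D"
    using assms(2) unfolding domino_join_def by auto
qed

text \<open>These pairs will correspond to the tilings without free bifences.\<close>

definition disjoint_pairs :: "nat \<Rightarrow> (nat set \<times> nat set) set" where
  "disjoint_pairs n = {(A, B) \<in> domino_sets n \<times> domino_sets n. A \<inter> B = {}}"

definition last_common :: "nat \<Rightarrow> nat \<Rightarrow> (nat set \<times> nat set) set" where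
  "last_common n m = {(A, B) \<in> domino_sets n \<times> domino_sets n.
     m \<in> A \<inter> B \<and> (\<forall>i \<in> A \<inter> B. i \<le> m)}"

text \<open>Beyond \<open>m\<close>, the common dominoes of the two joins are exactly the shifted
  common dominoes of their right parts.\<close>

lemma domino_join_common:
  assumes "L \<in> domino_sets m" "L' \<in> domino_sets m"
  shows "(\<forall>i \<in> domino_join m L R \<inter> domino_join m L' R'. i \<le> m) \<longleftrightarrow> R \<inter> R' = {}"
proof -
  have "domino_join m L R \<inter> domino_join m L' R' =
    insert m (L \<inter> L') \<union> (\<lambda>i. i + m + 2) ` (R \<inter> R')"
    using domino_sets_subset[OF assms(1)] domino_sets_subset[OF assms(2)]
    by (auto simp: domino_join_def)
  moreover have "i \<le> m" if "i \<in> L" for i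
    using that domino_sets_subset[OF assms(1)] by auto
  ultimately show ?thesis by (auto simp: ball_Un disjoint_iff)
qed

text \<open>The two left parts are arbitrary and independent, which gives the square. The right
  parts must have no domino in common.\<close>

lemma card_last_common:
  "card (last_common (m + 2 + r) m) = (fib (m + 1))\<^sup>2 * card (disjoint_pairs r)"
proof -
  let ?f = "\<lambda>((L, L'), (R, R')). (domino_join m L R, domino_join m L' R')"
  let ?g = "\<lambda>(A, B). ((A \<inter> {..<m}, B \<inter> {..<m}),
    ({i::nat. i + m + 2 \<in> A}, {i::nat. i + m + 2 \<in> B}))"
  have join_last: "m \<in> domino_join m L R" for L R by (simp add: domino_join_def)
  have "bij_betw ?f ((domino_sets m \<times> domino_sets m) \<times> disjoint_pairs r)
    (last_common (m + 2 + r) m)"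
  proof (rule bij_betw_byWitness[where f' = ?g])
    show "\<forall>a\<in>(domino_sets m \<times> domino_sets m) \<times> disjoint_pairs r. ?g (?f a) = a"
      using domino_join_left domino_join_right by (auto simp: disjoint_pairs_def)
    show "\<forall>a\<in>last_common (m + 2 + r) m. ?f (?g a) = a"
      using domino_join_split(3) by (auto simp: last_common_def)
    show "?f ` ((domino_sets m \<times> domino_sets m) \<times> disjoint_pairs r) \<subseteq> last_common (m + 2 + r) m"
    proof
      fix p assume "p \<in> ?f ` ((domino_sets m \<times> domino_sets m) \<times> disjoint_pairs r)"
      then obtain L L' R R' where p: "p = (domino_join m L R, domino_join m L' R')"
        and L: "L \<in> domino_sets m" "L' \<in> domino_sets m"
        and R: "R \<in> domino_sets r" "R' \<in> domino_sets r" "R \<inter> R' = {}"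
        by (auto simp: disjoint_pairs_def)
      show "p \<in> last_common (m + 2 + r) m"
        unfolding p last_common_def
        using domino_join_in[OF L(1) R(1)] domino_join_in[OF L(2) R(2)]
          domino_join_common[OF L, of R R'] R(3) join_last by blast
    qed
    show "?g ` last_common (m + 2 + r) m \<subseteq> (domino_sets m \<times> domino_sets m) \<times> disjoint_pairs r"
    proof
      fix p assume "p \<in> ?g ` last_common (m + 2 + r) m"
      then obtain A B where p: "p = ?g (A, B)"
        and A: "A \<in> domino_sets (m + 2 + r)" "m \<in> A"
        and B: "B \<in> domino_sets (m + 2 + r)" "m \<in> B"
        and le: "\<forall>i \<in> A \<inter> B. i \<le> m"
        by (auto simp: last_common_def)
      have "\<not> (i + m + 2 \<in> A \<and> i + m + 2 \<in> B)" for i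
        using bspec[OF le, of "i + m + 2"] by auto
      then show "p \<in> (domino_sets m \<times> domino_sets m) \<times> disjoint_pairs r"
        using domino_join_split(1,2)[OF A] domino_join_split(1,2)[OF B]
        by (auto simp: p disjoint_pairs_def)
    qed
  qed
  from bij_betw_same_card[OF this] show ?thesis
    by (simp add: card_cartesian_product card_domino_sets power2_eq_square)
qed

text \<open>All pairs are classified by their last common domino, if there is one. The index
  \<open>k\<close> is the number of cells up to the end of that domino, so the domino starts at
  \<open>k - 2\<close> and \<open>n - k\<close> cells remain.\<close>

lemma fib_square_disjoint_pairs:
  "(fib (n + 1))\<^sup>2 =
    card (disjoint_pairs n) + (\<Sum>k = 2..n. (fib (k - 1))\<^sup>2 * card (disjoint_pairs (n - k)))"
proof -
  let ?P = "domino_sets n \<times> domino_sets n"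
  let ?U = "\<Union>k\<in>{2..n}. last_common n (k - 2)"
  have finP: "finite ?P" by (simp add: finite_domino_sets)
  have sub: "disjoint_pairs n \<subseteq> ?P" "last_common n m \<subseteq> ?P" for m
    by (auto simp: disjoint_pairs_def last_common_def)
  have "?P \<subseteq> disjoint_pairs n \<union> ?U"
  proof
    fix p assume "p \<in> ?P"
    then obtain A B where p: "p = (A, B)" and A: "A \<in> domino_sets n" and B: "B \<in> domino_sets n"
      by auto
    show "p \<in> disjoint_pairs n \<union> ?U"
    proof (cases "A \<inter> B = {}")
      case True
      then show ?thesis using p A B by (auto simp: disjoint_pairs_def)
    next
      case False
      define m where "m = Max (A \<inter> B)"
      have fin: "finite (A \<inter> B)"
        using domino_sets_subset[OF A] by (meson finite_Int finite_lessThan finite_subset)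
      have m: "m \<in> A \<inter> B" "\<forall>i \<in> A \<inter> B. i \<le> m"
        using Max_in[OF fin False] Max_ge[OF fin] unfolding m_def by blast+
      have "p \<in> last_common n (m + 2 - 2)" using p A B m by (auto simp: last_common_def)
      moreover have "m + 2 \<in> {2..n}" using A m(1) by (auto simp: domino_sets_def)
      ultimately show ?thesis by blast
    qed
  qed
  then have P: "?P = disjoint_pairs n \<union> ?U" using sub by blast
  have disj: "disjoint_pairs n \<inter> ?U = {}"
    by (auto simp: disjoint_pairs_def last_common_def)
  \<comment> \<open>Truncated subtraction makes \<open>k - 2\<close> injective only from
    \<open>k = 2\<close> on, hence the range conditions.\<close>
  have inj: "last_common n (k - 2) \<inter> last_common n (l - 2) = {}"
    if "k \<in> {2..n}" "l \<in> {2..n}" "k \<noteq> l" for k l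
  proof -
    have "m = m'" if "p \<in> last_common n m" "p \<in> last_common n m'" for p m m'
      using that by (auto simp: last_common_def intro: antisym)
    then show ?thesis using that by (metis (no_types, lifting) atLeastAtMost_iff disjoint_iff diff_add_inverse le_Suc_ex)
  qed
  have "(fib (n + 1))\<^sup>2 = card ?P"
    by (simp add: card_cartesian_product card_domino_sets power2_eq_square)
  also have "\<dots> = card (disjoint_pairs n) + card ?U"
    unfolding P by (rule card_Un_disjoint) (use finite_subset[OF _ finP] sub disj in auto)
  also have "card ?U = (\<Sum>k = 2..n. card (last_common n (k - 2)))"
    by (rule card_UN_disjoint) (use inj finite_subset[OF sub(2) finP] in auto)
  also have "\<dots> = (\<Sum>k = 2..n. (fib (k - 1))\<^sup>2 * card (disjoint_pairs (n - k)))"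
  proof (rule sum.cong)
    fix k assume "k \<in> {2..n}"
    then have "n = (k - 2) + 2 + (n - k)" "k - 2 + 1 = k - 1" by auto
    then show "card (last_common n (k - 2)) = (fib (k - 1))\<^sup>2 * card (disjoint_pairs (n - k))"
      using card_last_common[of "k - 2" "n - k"] by simp
  qed simp
  finally show ?thesis .
qed

section \<open>Alignment of the tiles with the half-cells\<close>

text \<open>A piece of width 1/2 is represented by its left edge.\<close>

fun posts :: "tile \<Rightarrow> real set" where
  "posts (HalfSquare x) = {x}"
| "posts (Fence x) = {x, x + 1}"

definition half_grid :: "nat \<Rightarrow> real set" where
  "half_grid n = (\<lambda>j. real j / 2) ` {..<2 * n}"

text \<open>Combinatorial counterpart of \<open>tiling\<close>: an overlap becomes a shared post,
  and alignment is built in.\<close>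

definition grid_tiling :: "nat \<Rightarrow> tile set \<Rightarrow> bool" where
  "grid_tiling n T \<longleftrightarrow>
     pairwise (\<lambda>s t. posts s \<inter> posts t = {}) T \<and> (\<Union>t\<in>T. posts t) = half_grid n"

lemma region_eq_posts: "region t = (\<Union>p\<in>posts t. {p..p + 1/2})"
  by (cases t) (auto simp: field_simps)

lemma board_eq: "board n = (\<Union>p\<in>half_grid n. {p..p + 1/2})"
proof -
  have "(\<Union>p\<in>half_grid n. {p..p + 1/2}) = (\<Union>j<2 * n. {real j / 2..real j / 2 + 1/2})"
    by (auto simp: half_grid_def)
  also have "\<dots> = (\<Union>i<n. {real i..real i + 1})"
  proof (induction n)
    case (Suc n)
    have "{..<2 * Suc n} = {..<2 * n} \<union> {2 * n, 2 * n + 1}" by auto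
    moreover have "{real n..real n + 1} = {real n..real n + 1/2} \<union> {real n + 1/2..real n + 1}"
      by auto
    ultimately show ?case using Suc by (simp add: lessThan_Suc add_divide_distrib Un_ac add.commute)
  qed simp
  finally show ?thesis by (simp add: board_def cells_def atLeast0LessThan)
qed

lemma board_subset: "board n \<subseteq> {0..real n}"
  by (fastforce simp: board_def cells_def)

text \<open>The cell numbered by the floor of \<open>x\<close> contains \<open>x\<close>. The strict
  upper bound keeps this cell on the board.\<close>

lemma mem_board:
  assumes "0 \<le> x" "x < real n"
  shows "x \<in> board n"
proof -
  have "real (nat \<lfloor>x\<rfloor>) \<le> x" "x \<le> real (nat \<lfloor>x\<rfloor>) + 1" "nat \<lfloor>x\<rfloor> < n"
    using assms by linarith+
  then show ?thesis unfolding board_def cells_def by (intro UN_I[of "nat \<lfloor>x\<rfloor>"]) auto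
qed

lemma posts_separated:
  assumes "interior (region s) \<inter> interior (region t) = {}" "p \<in> posts s" "q \<in> posts t"
  shows "1/2 \<le> \<bar>p - q\<bar>"
proof (rule ccontr)
  assume *: "\<not> 1/2 \<le> \<bar>p - q\<bar>"
  \<comment> \<open>The midpoint of the overlap, which runs from \<open>max p q\<close> to
    \<open>min p q + 1/2\<close>.\<close>
  define x where "x = (max p q + min p q + 1/2) / 2"
  have "{p<..<p + 1/2} \<subseteq> interior (region t)" if "p \<in> posts t" for p t
  proof -
    have "{p..p + 1/2} \<subseteq> region t" unfolding region_eq_posts using that by blast
    from interior_mono[OF this] show ?thesis by simp
  qed
  from this[OF assms(2)] this[OF assms(3)]
  have "{p<..<p + 1/2} \<subseteq> interior (region s)" "{q<..<q + 1/2} \<subseteq> interior (region t)" .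
  moreover have "x \<in> {p<..<p + 1/2}" "x \<in> {q<..<q + 1/2}"
    using * by (auto simp: x_def max_def min_def abs_if field_simps split: if_splits)
  ultimately show False using assms(1) by blast
qed

lemma half_grid_separated:
  assumes "p \<in> half_grid n" "q \<in> half_grid n" "p \<noteq> q"
  shows "1/2 \<le> \<bar>p - q\<bar>"
proof -
  obtain i j where "p = real i / 2" "q = real j / 2" "i \<noteq> j"
    using assms by (auto simp: half_grid_def)
  then have "1 \<le> \<bar>real i - real j\<bar>" by linarith
  then show ?thesis using \<open>p = _\<close> \<open>q = _\<close> by (simp add: abs_if field_simps split: if_splits)
qed

text \<open>Positions are forced from left to right: points just after the end of one piece can only
  be covered by a piece that starts at this end. Once every grid point is occupied, no other
  position is far enough from all of them.\<close>

lemma separated_cover_eq_half_grid: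
  assumes sep: "\<And>p q. p \<in> P \<Longrightarrow> q \<in> P \<Longrightarrow> p \<noteq> q \<Longrightarrow> 1/2 \<le> \<bar>p - q\<bar>"
    and cover: "(\<Union>p\<in>P. {p..p + 1/2}) = board n"
  shows "P = half_grid n"
proof -
  have bounds: "0 \<le> p" "p + 1/2 \<le> real n" if "p \<in> P" for p
  proof -
    have "{p..p + 1/2} \<subseteq> {0..real n}" using that cover board_subset by blast
    then show "0 \<le> p" "p + 1/2 \<le> real n" by auto
  qed
  have covered: "\<exists>p\<in>P. p \<le> x \<and> x \<le> p + 1/2" if "0 \<le> x" "x < real n" for x
    using mem_board[OF that] cover[symmetric] by auto
  have grid: "real j / 2 \<in> P" if "j < 2 * n" for j
    using that
  proof (induction j)
    case 0
    then obtain p where "p \<in> P" "p \<le> 0" using covered[of 0] by auto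
    then show ?case using bounds(1)[of p] by simp
  next
    case (Suc j)
    define x where "x = real (Suc j) / 2"
    have "real (Suc (Suc j)) \<le> 2 * real n" using Suc.prems by linarith
    then have x: "x + 1/2 \<le> real n" by (simp add: x_def field_simps)
    have j: "real j / 2 \<in> P" using Suc by simp
    \<comment> \<open>The piece that covers \<open>x + e\<close> starts after
      \<open>real j / 2\<close>, and separation then pushes its start to \<open>x\<close> or
      beyond.\<close>
    have near: "\<exists>p\<in>P. x \<le> p \<and> p \<le> x + e" if e: "0 < e" "e < 1/2" for e
    proof -
      obtain p where p: "p \<in> P" "p \<le> x + e" "x + e \<le> p + 1/2"
        using covered[of "x + e"] x e by (auto simp: x_def)
      then have "real j / 2 < p" using e by (simp add: x_def field_simps)
      then show ?thesis using p sep[OF p(1) j] by (auto simp: x_def field_simps)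
    qed
    obtain p where p: "p \<in> P" "x \<le> p" "p \<le> x + 1/4" using near[of "1/4"] by auto
    have "x \<in> P"
    proof (rule ccontr)
      assume "x \<notin> P"
      then have "x < p" using p by (metis order_le_less)
      \<comment> \<open>Halving the distance to \<open>p\<close> yields a second start
        \<open>q\<close> strictly before \<open>p\<close> but within 1/4 of it, against
        separation.\<close>
      then have "0 < (p - x) / 2" "(p - x) / 2 < 1/2" using p(3) by auto
      from near[OF this] obtain q where q: "q \<in> P" "x \<le> q" "q \<le> x + (p - x) / 2"
        by blast
      then have "q < p" using \<open>x < p\<close> by (simp add: field_simps)
      then have "1/2 \<le> \<bar>p - q\<bar>" using sep[OF p(1) q(1)] by blast
      then show False using \<open>q < p\<close> p q by linarith
    qed
    then show ?case by (simp add: x_def)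
  qed
  show ?thesis
  proof (intro equalityI subsetI)
    fix p assume p: "p \<in> P"
    \<comment> \<open>The half-cell \<open>j\<close> contains \<open>p\<close>, so \<open>p\<close>
      is less than 1/2 away from \<open>real j / 2\<close>, which lies in \<open>P\<close>.
      Separation leaves only equality.\<close>
    define j where "j = nat \<lfloor>2 * p\<rfloor>"
    have j: "real j \<le> 2 * p" "2 * p < real j + 1" using bounds(1)[OF p] by (auto simp: j_def)
    have "j < 2 * n" using j(1) bounds(2)[OF p] by linarith
    then have "p = real j / 2" using sep[OF p grid[of j]] j by (auto simp: abs_if split: if_splits)
    then show "p \<in> half_grid n" using \<open>j < 2 * n\<close> by (auto simp: half_grid_def)
  qed (auto simp: half_grid_def grid)
qed

text \<open>Disjoint interiors separate the posts of different tiles, and the posts of one fence are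
  1 apart, so the posts form a separated cover. Conversely, distinct grid posts keep regions from
  meeting in more than finitely many points.\<close>

lemma tiling_iff_grid_tiling: "tiling n T \<longleftrightarrow> grid_tiling n T"
proof
  assume "tiling n T"
  then have int: "\<And>s t. s \<in> T \<Longrightarrow> t \<in> T \<Longrightarrow> s \<noteq> t \<Longrightarrow>
      interior (region s) \<inter> interior (region t) = {}"
    and cover: "(\<Union>t\<in>T. region t) = board n"
    unfolding tiling_def exactly_covers_def pairwise_def by blast+
  have "(\<Union>t\<in>T. posts t) = half_grid n"
  proof (rule separated_cover_eq_half_grid)
    fix p q assume "p \<in> (\<Union>t\<in>T. posts t)" "q \<in> (\<Union>t\<in>T. posts t)" "p \<noteq> q"
    then obtain s t where st: "s \<in> T" "t \<in> T" "p \<in> posts s" "q \<in> posts t" by auto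
    show "1/2 \<le> \<bar>p - q\<bar>"
    proof (cases "s = t")
      case True
      then show ?thesis using st \<open>p \<noteq> q\<close> by (cases t) auto
    next
      case False
      then show ?thesis using posts_separated int st by blast
    qed
  next
    show "(\<Union>p\<in>\<Union>t\<in>T. posts t. {p..p + 1/2}) = board n"
      using cover by (simp add: region_eq_posts)
  qed
  moreover have "pairwise (\<lambda>s t. posts s \<inter> posts t = {}) T"
    unfolding pairwise_def using posts_separated[OF int] by fastforce
  ultimately show "grid_tiling n T" by (simp add: grid_tiling_def)
next
  assume T: "grid_tiling n T"
  then have posts: "(\<Union>t\<in>T. posts t) = half_grid n" by (simp add: grid_tiling_def)
  have "interior (region s) \<inter> interior (region t) = {}" if st: "s \<in> T" "t \<in> T" "s \<noteq> t" for s t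
  proof -
    \<comment> \<open>Two intervals of length 1/2 whose starts are at least 1/2 apart meet at most
      where one of them starts.\<close>
    have "region s \<inter> region t \<subseteq> posts s \<union> posts t"
    proof
      fix x assume "x \<in> region s \<inter> region t"
      then obtain p q where pq: "p \<in> posts s" "q \<in> posts t" "p \<le> x" "x \<le> p + 1/2" "q \<le> x" "x \<le> q + 1/2"
        by (auto simp: region_eq_posts)
      have "p \<noteq> q" using T st pq by (auto simp: grid_tiling_def pairwise_def)
      then have "1/2 \<le> \<bar>p - q\<bar>" using half_grid_separated posts st pq by blast
      then have "x = p \<or> x = q" using pq by (auto simp: abs_if split: if_splits)
      then show "x \<in> posts s \<union> posts t" using pq by auto
    qed
    moreover have "finite (posts t)" for t by (cases t) auto
    ultimately have "finite (region s \<inter> region t)" by (meson finite_UnI finite_subset)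
    then show ?thesis unfolding interior_Int[symmetric] by (rule empty_interior_finite)
  qed
  moreover have "(\<Union>t\<in>T. region t) = board n"
    unfolding board_eq posts[symmetric] by (simp add: region_eq_posts)
  ultimately show "tiling n T"
    by (simp add: tiling_def exactly_covers_def pairwise_def)
qed

section \<open>Decomposition of a tiling into two rows\<close>

text \<open>The offset \<open>s\<close> is 0 for the left halves of the cells and 1/2 for the right
  halves. A fence plays the part of a domino in its row.\<close>

definition fences :: "real \<Rightarrow> tile set \<Rightarrow> nat set" where
  "fences s T = {i. Fence (s + real i) \<in> T}"

text \<open>Cells outside all dominoes are the squares, realised by half-squares.\<close>

definition row :: "nat \<Rightarrow> real \<Rightarrow> nat set \<Rightarrow> tile set" where
  "row n s D = (\<lambda>i. Fence (s + real i)) ` D \<union>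
     (\<lambda>i. HalfSquare (s + real i)) ` ({..<n} - D - Suc ` D)"

lemma half_grid_eq: "half_grid n = (\<Union>s\<in>{0, 1/2}. (\<lambda>i. s + real i) ` {..<n})"
proof (induction n)
  case (Suc n)
  have "{..<2 * Suc n} = {..<2 * n} \<union> {2 * n, 2 * n + 1}" by auto
  then have "half_grid (Suc n) = half_grid n \<union> {real n, 1/2 + real n}"
    by (simp add: half_grid_def add_divide_distrib)
  then show ?case using Suc by (auto simp: lessThan_Suc)
qed (simp add: half_grid_def)

text \<open>Doubling would equate an odd and an even number. This is what keeps the two rows
  apart.\<close>

lemma half_plus_nat_neq: "1/2 + real i \<noteq> real j"
proof
  assume "1/2 + real i = real j"
  then have "1 + 2 * real i = 2 * real j" by simp
  then have "1 + 2 * i = 2 * j" by linarith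
  then show False by presburger
qed

lemma row_offset_eq:
  assumes "s \<in> {0, 1/2}" "s' \<in> {0, 1/2}" "s + real i = s' + real j"
  shows "s = s' \<and> i = j"
  using assms half_plus_nat_neq[of i j] half_plus_nat_neq[of j i] by auto

lemma mem_half_grid:
  assumes "s \<in> {0, 1/2}"
  shows "s + real i \<in> half_grid n \<longleftrightarrow> i < n"
proof
  assume "s + real i \<in> half_grid n"
  then obtain s' j where "s' \<in> {0, 1/2}" "s + real i = s' + real j" "j < n"
    unfolding half_grid_eq by blast
  then show "i < n" using row_offset_eq[OF assms] by blast
next
  assume "i < n"
  then show "s + real i \<in> half_grid n" unfolding half_grid_eq using assms by blast
qed

lemma fences_row:
  "fences 0 (row n 0 A \<union> row n (1/2) B) = A"
  "fences (1/2) (row n 0 A \<union> row n (1/2) B) = B"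
  by (auto simp: fences_def row_def half_plus_nat_neq half_plus_nat_neq[symmetric])

lemma posts_row:
  assumes "D \<in> domino_sets n"
  shows "(\<Union>t\<in>row n s D. posts t) = (\<lambda>i. s + real i) ` {..<n}"
proof -
  have "(\<Union>t\<in>row n s D. posts t) = (\<lambda>i. s + real i) ` D \<union> (\<lambda>i. s + real (Suc i)) ` D \<union>
      (\<lambda>i. s + real i) ` ({..<n} - D - Suc ` D)"
    by (auto simp: row_def ac_simps)
  also have "\<dots> = (\<lambda>i. s + real i) ` (D \<union> Suc ` D \<union> ({..<n} - D - Suc ` D))"
    by (simp add: image_Un image_image)
  also have "D \<subseteq> {..<n}" "Suc ` D \<subseteq> {..<n}"
    using assms domino_sets_subset by (auto simp: domino_sets_def)
  then have "D \<union> Suc ` D \<union> ({..<n} - D - Suc ` D) = {..<n}" by blast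
  finally show ?thesis .
qed

text \<open>Distinct fences could share a post only if they started at neighbouring cells, which a
  domino set excludes. Half-squares avoid both cells of every domino.\<close>

lemma posts_disjoint_row:
  assumes "D \<in> domino_sets n" "t \<in> row n s D" "t' \<in> row n s D" "t \<noteq> t'"
  shows "posts t \<inter> posts t' = {}"
proof -
  have *: "Suc i \<notin> D" if "i \<in> D" for i using assms(1) that by (auto simp: domino_sets_def)
  have eq: "s + real i = s + real j + 1 \<longleftrightarrow> i = Suc j" "s + real j + 1 = s + real i \<longleftrightarrow> i = Suc j" for i j
    by linarith+
  show ?thesis using assms(2-4) * by (auto simp: row_def eq)
qed

lemma grid_tiling_row:
  assumes "A \<in> domino_sets n" "B \<in> domino_sets n"
  shows "grid_tiling n (row n 0 A \<union> row n (1/2) B)"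
proof -
  have "(\<lambda>i. 0 + real i) ` {..<n} \<inter> (\<lambda>i. 1/2 + real i) ` {..<n} = {}"
    using half_plus_nat_neq half_plus_nat_neq[symmetric] by auto
  then have "(\<Union>t\<in>row n 0 A. posts t) \<inter> (\<Union>t\<in>row n (1/2) B. posts t) = {}"
    using posts_row[OF assms(1), of 0] posts_row[OF assms(2), of "1/2"] by simp
  then have "posts s \<inter> posts t = {}" "posts t \<inter> posts s = {}"
    if "s \<in> row n 0 A" "t \<in> row n (1/2) B" for s t
    using that by blast+
  then have "pairwise (\<lambda>s t. posts s \<inter> posts t = {}) (row n 0 A \<union> row n (1/2) B)"
    using posts_disjoint_row[OF assms(1)] posts_disjoint_row[OF assms(2)]
    unfolding pairwise_def by (metis Un_iff)
  then show ?thesis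
    by (simp add: grid_tiling_def half_grid_eq UN_Un posts_row assms)
qed

context
  fixes n T assumes T: "grid_tiling n T"
begin

lemma grid_tiling_unique: "t \<in> T \<Longrightarrow> t' \<in> T \<Longrightarrow> p \<in> posts t \<Longrightarrow> p \<in> posts t' \<Longrightarrow> t = t'"
  using T by (auto simp: grid_tiling_def pairwise_def)

lemma grid_tiling_posts: "t \<in> T \<Longrightarrow> p \<in> posts t \<Longrightarrow> p \<in> half_grid n"
  using T by (auto simp: grid_tiling_def)

text \<open>The second post of a fence at \<open>i\<close> occupies cell \<open>Suc i\<close> of the
  same row. That cell is therefore on the board, and no other fence can start there.\<close>

lemma fences_in_domino_sets:
  assumes s: "s \<in> {0, 1/2}"
  shows "fences s T \<in> domino_sets n"
proof -
  have "Suc i < n \<and> Fence (s + real (Suc i)) \<notin> T" if "Fence (s + real i) \<in> T" for i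
  proof -
    have post: "s + real (Suc i) \<in> posts (Fence (s + real i))" by simp
    show ?thesis
      using grid_tiling_posts[OF that post] mem_half_grid[OF s]
        grid_tiling_unique[OF that _ post] by fastforce
  qed
  then show ?thesis by (simp add: domino_sets_def fences_def)
qed

lemma mem_row_fences:
  assumes s: "s \<in> {0, 1/2}"
  shows "t \<in> row n s (fences s T) \<longleftrightarrow> t \<in> T \<and> (\<exists>i. s + real i \<in> posts t)"
proof
  assume t: "t \<in> row n s (fences s T)"
  have "t \<in> T" if "t = HalfSquare (s + real i)" "i < n" "i \<notin> fences s T" "i \<notin> Suc ` fences s T" for i
  proof -
    have "s + real i \<in> half_grid n" using that(2) mem_half_grid[OF s] by blast
    then obtain u where u: "u \<in> T" "s + real i \<in> posts u" using T by (auto simp: grid_tiling_def)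
    show ?thesis
    proof (cases u)
      case (HalfSquare x)
      then show ?thesis using u that by simp
    next
      case (Fence x)
      \<comment> \<open>No fence starts at \<open>i\<close>, so the post hit here is the second
        one.\<close>
      then have "x = s + real i - 1" using u that(3) by (auto simp: fences_def)
      moreover have "x \<in> half_grid n" using grid_tiling_posts[OF u(1)] Fence by simp
      then have "0 \<le> x" by (auto simp: half_grid_def)
      \<comment> \<open>For \<open>i = 0\<close> the left edge would be \<open>s - 1\<close>, off
        the board.\<close>
      ultimately obtain k where "i = Suc k" using s by (cases i) auto
      then have "k \<in> fences s T" using u Fence \<open>x = _\<close> by (simp add: fences_def)
      then show ?thesis using that(4) \<open>i = Suc k\<close> by simp
    qed
  qed
  then show "t \<in> T \<and> (\<exists>i. s + real i \<in> posts t)" using t by (auto simp: row_def fences_def)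
next
  assume "t \<in> T \<and> (\<exists>i. s + real i \<in> posts t)"
  then obtain i where t: "t \<in> T" and i: "s + real i \<in> posts t" by auto
  show "t \<in> row n s (fences s T)"
  proof (cases t)
    case (HalfSquare x)
    then have x: "x = s + real i" using i by simp
    have "i < n" using grid_tiling_posts[OF t i] mem_half_grid[OF s] by blast
    moreover have "i \<notin> fences s T"
      using grid_tiling_unique[OF t _ i] HalfSquare by (force simp: fences_def)
    moreover have "i \<notin> Suc ` fences s T"
      using grid_tiling_unique[OF t _ i] HalfSquare by (force simp: fences_def)
    ultimately show ?thesis using x HalfSquare by (auto simp: row_def)
  next
    case (Fence x)
    then have "x \<in> half_grid n" using grid_tiling_posts[OF t] by simp
    then obtain s' k where s': "s' \<in> {0, 1/2}" and x: "x = s' + real k"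
      unfolding half_grid_eq by blast
    have "s + real i = s' + real k \<or> s + real i = s' + real (Suc k)" using Fence i x by auto
    then have "s = s'" using row_offset_eq[OF s s'] by blast
    then show ?thesis using t Fence x by (auto simp: row_def fences_def)
  qed
qed

text \<open>Every tile has a post on the half-grid, hence lies in one of the rows. So
  \<open>row\<close> recovers a tiling from its two fence sets.\<close>

lemma row_fences: "row n 0 (fences 0 T) \<union> row n (1/2) (fences (1/2) T) = T"
proof -
  have "\<exists>s\<in>{0, 1/2}. \<exists>i. s + real i \<in> posts t" if "t \<in> T" for t
  proof -
    obtain p where "p \<in> posts t" by (cases t) auto
    then show ?thesis using grid_tiling_posts[OF that] by (force simp: half_grid_eq)
  qed
  then show ?thesis using mem_row_fences[of 0] mem_row_fences[of "1/2"] by blast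
qed

end

lemma tilings_bij_domino_sets:
  "bij_betw (\<lambda>T. (fences 0 T, fences (1/2) T)) {T. tiling n T} (domino_sets n \<times> domino_sets n)"
  by (rule bij_betw_byWitness[where f' = "\<lambda>(A, B). row n 0 A \<union> row n (1/2) B"])
    (auto simp: tiling_iff_grid_tiling row_fences fences_in_domino_sets grid_tiling_row fences_row)

section \<open>Free bifences as common dominoes\<close>

lemma cells_eq: "a < b \<Longrightarrow> cells a b = {real a..real b}"
proof (induction b)
  case (Suc b)
  show ?case
  proof (cases "a = b")
    case False
    then show ?thesis using Suc by (auto simp: cells_def atLeastLessThanSuc)
  qed (auto simp: cells_def)
qed simp

lemma cells_eq_empty: "\<not> a < b \<Longrightarrow> cells a b = {}"
  by (simp add: cells_def)

lemma bifence_region: "(\<Union>t\<in>bifence x. region t) = {x..x + 2}"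
  unfolding bifence_def by (simp, intro equalityI subsetI) auto

lemma not_covers_cells_Fence: "\<not> covers_cells {Fence x}"
proof
  assume "covers_cells {Fence x}"
  then obtain a b where eq: "{x..x + 1/2} \<union> {x + 1..x + 3/2} = cells a b"
    by (auto simp: covers_cells_def exactly_covers_def)
  \<comment> \<open>\<open>x + 3/4\<close> is the middle of the gap, between two covered points,
    whereas a block of cells is convex.\<close>
  have mem: "x \<in> cells a b" "x + 3/2 \<in> cells a b" "x + 3/4 \<notin> cells a b"
    unfolding eq[symmetric] by auto
  then show False by (cases "a < b") (auto simp: cells_eq cells_eq_empty)
qed

text \<open>A bifence fills an interval of length 2, which is a block of cells just when it starts
  at a cell boundary. It is then minimal because a single fence leaves its gap open.\<close>

lemma metatile_bifence_iff: "metatile (bifence x) \<longleftrightarrow> (\<exists>i. x = real i)"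
proof
  assume "metatile (bifence x)"
  then have "covers_cells (bifence x)" by (simp add: metatile_def)
  then obtain a b where eq: "{x..x + 2} = cells a b"
    by (auto simp: covers_cells_def exactly_covers_def bifence_region)
  have "a < b" using eq cells_eq_empty[of a b] by (cases "a < b") auto
  then have "x = real a" using eq by (simp add: cells_eq Icc_eq_Icc)
  then show "\<exists>i. x = real i" ..
next
  assume "\<exists>i. x = real i"
  then obtain i where x: "x = real i" ..
  have "interior (region (Fence x)) \<inter> interior (region (Fence (x + 1/2))) = {}"
  proof -
    \<comment> \<open>The four posts alternate between the two fences and touch at these three
      points.\<close>
    have "region (Fence x) \<inter> region (Fence (x + 1/2)) \<subseteq> {x + 1/2, x + 1, x + 3/2}" by auto
    then have "finite (region (Fence x) \<inter> region (Fence (x + 1/2)))"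
      by (rule finite_subset) simp
    then show ?thesis unfolding interior_Int[symmetric] by (rule empty_interior_finite)
  qed
  then have "pairwise (\<lambda>s t. interior (region s) \<inter> interior (region t) = {}) (bifence x)"
    unfolding bifence_def by (simp add: pairwise_insert Int_commute del: region.simps)
  moreover have "(\<Union>t\<in>bifence x. region t) = cells i (i + 2)"
    using x unfolding bifence_region by (simp add: cells_eq)
  ultimately have "covers_cells (bifence x)"
    unfolding covers_cells_def exactly_covers_def by blast
  moreover have "\<not> covers_cells N" if "N \<subset> bifence x" "N \<noteq> {}" for N
  proof -
    have "N = {Fence x} \<or> N = {Fence (x + 1/2)}" using that by (auto simp: bifence_def)
    then show ?thesis using not_covers_cells_Fence by auto
  qed
  moreover have "bifence x \<noteq> {}" by (simp add: bifence_def)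
  ultimately show "metatile (bifence x)" unfolding metatile_def by blast
qed

text \<open>A bifence at a cell boundary consists of fences starting in the two halves of one cell,
  that is, of the same domino in both rows.\<close>

lemma free_bifence_iff: "(\<exists>x. free_bifence_in T x) \<longleftrightarrow> fences 0 T \<inter> fences (1/2) T \<noteq> {}"
  unfolding free_bifence_in_def metatile_bifence_iff
  by (auto simp: fences_def bifence_def add.commute)

lemma S_eq_card_disjoint_pairs: "S n = card (disjoint_pairs n)"
proof -
  let ?f = "\<lambda>T. (fences 0 T, fences (1/2) T)"
  let ?X = "{T. tiling n T \<and> \<not> (\<exists>x. free_bifence_in T x)}"
  have bij: "bij_betw ?f {T. tiling n T} (domino_sets n \<times> domino_sets n)"
    by (rule tilings_bij_domino_sets)
  have "inj_on ?f ?X" using bij by (auto simp: bij_betw_def intro: inj_on_subset)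
  moreover have "?f ` ?X = disjoint_pairs n"
  proof -
    \<comment> \<open>Freeness depends only on the pair of fence sets, so the restriction carries
      over to the image.\<close>
    have "?f ` ?X = {p \<in> ?f ` {T. tiling n T}. fst p \<inter> snd p = {}}"
      unfolding free_bifence_iff by auto
    then show ?thesis using bij by (auto simp: bij_betw_def disjoint_pairs_def)
  qed
  ultimately show ?thesis unfolding S_def using card_image by metis
qed

theorem mainTheorem5:
  fixes n :: nat
  shows "(fib (n + 1))\<^sup>2 = S n + (\<Sum>k = 2..n. (fib (k - 1))\<^sup>2 * S (n - k))"
  unfolding S_eq_card_disjoint_pairs by (rule fib_square_disjoint_pairs)

end
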